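(* Let $X$ and $Y$ be real Banach spaces, $K\colon X\to Y$ a bounded linear mapping and $F\colon Y\to\overline{\mathbb R}$ a diconvex mapping. Then, for every $u\in X$, $$\bigl(K\times(K\otimes_{\pi,\mathrm{sym}}K)\bigr)^*\,\partial_\beta F(K(u))\subset\partial_\beta(F\circ K)(u).$$
   Context: $\overline{\mathbb R}=\mathbb R\cup\{\pm\infty\}$; a functional is proper if it is never $-\infty$ and not identically $+\infty$. $X\otimes_{\pi,\mathrm{sym}}X$ is the closed subspace of the (completed) projective tensor product $X\otimes_\pi X$ spanned by the tensors $u\otimes u$, $u\in X$. A mapping $F\colon X\to\overline{\mathbb R}$ is diconvex if there is a proper, convex $\breve F\colon X\times(X\otimes_{\pi,\mathrm{sym}}X)\to\overline{\mathbb R}$ with $F(u)=\breve F(u,u\otimes u)$ for all $u\in X$. The dilinear subdifferential $\partial_\beta F(u)$ of $F\colon X\to\overline{\mathbb R}$ at $u$ is the set of all $(\xi,\Xi)\in X^*\times(X\otimes_{\pi,\mathrm{sym}}X)^*$ such that $F(u)$ is finite and $F(v)\ge F(u)+\langle\xi,v-u\rangle+\langle\Xi,v\otimes v-u\otimes u\rangle$ for all $v\in X$ (empty if no such element exists). For bounded linear $K\colon X\to Y$, $K\otimes_\pi K\colon X\otimes_\pi X\to Y\otimes_\pi Y$ is the unique bounded linear operator with $(K\otimes_\pi K)(u\otimes v)=K(u)\otimes K(v)$, and $K\otimes_{\pi,\mathrm{sym}}K\colon X\otimes_{\pi,\mathrm{sym}}X\to Y\otimes_{\pi,\mathrm{sym}}Y$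 is its restriction. $[K\times(K\otimes_{\pi,\mathrm{sym}}K)](u,w):=(K(u),(K\otimes_{\pi,\mathrm{sym}}K)(w))$, and $(\cdot)^*$ denotes the adjoint. *)

theory Defs
  imports "HOL-Analysis.Analysis"
begin

section \<open>The algebraic tensor product and the projective norm\<close>

text \<open>
  A list \<open>[(x\<^sub>1, y\<^sub>1), \<dots>, (x\<^sub>n, y\<^sub>n)]\<close> stands for the formal sum of the symbols \<open>x\<^sub>i \<otimes> y\<^sub>i\<close>
  (scalars can be absorbed into the first factor).  Two formal sums denote the same element of the
  algebraic tensor product iff no (not necessarily continuous) bilinear form separates them.
\<close>

definition form_val :: "('a::real_vector \<Rightarrow> 'b::real_vector \<Rightarrow> real) \<Rightarrow> ('a \<times> 'b) list \<Rightarrow> real"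
  where "form_val B xs = (\<Sum>(x, y)\<leftarrow>xs. B x y)"

definition same_tensor :: "('a::real_vector \<times> 'b::real_vector) list \<Rightarrow> ('a \<times> 'b) list \<Rightarrow> bool"
  where "same_tensor xs ys \<longleftrightarrow> (\<forall>B. bilinear B \<longrightarrow> form_val B xs = form_val B ys)"

definition scale_formal :: "real \<Rightarrow> ('a::real_vector \<times> 'b::real_vector) list \<Rightarrow> ('a \<times> 'b) list"
  where "scale_formal c xs = map (\<lambda>(x, y). (c *\<^sub>R x, y)) xs"

lemma form_val_Nil [simp]: "form_val B [] = 0"
  and form_val_Cons [simp]: "form_val B (p # xs) = B (fst p) (snd p) + form_val B xs"
  and form_val_append [simp]: "form_val B (xs @ ys) = form_val B xs + form_val B ys"
  by (simp_all add: form_val_def case_prod_beta)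

lemma form_val_scale [simp]: "bilinear B \<Longrightarrow> form_val B (scale_formal c xs) = c * form_val B xs"
  by (induction xs) (auto simp: scale_formal_def bilinear_lmul algebra_simps)

quotient_type (overloaded) ('a, 'b) alg_tensor =
  "('a::real_vector \<times> 'b::real_vector) list" / same_tensor
  by (intro equivpI reflpI sympI transpI) (auto simp: same_tensor_def)

instantiation alg_tensor :: (real_vector, real_vector) real_vector
begin

lift_definition zero_alg_tensor :: "('a, 'b) alg_tensor" is "[]" .

lift_definition plus_alg_tensor :: "('a, 'b) alg_tensor \<Rightarrow> ('a, 'b) alg_tensor \<Rightarrow> ('a, 'b) alg_tensor"
  is "(@)" by (simp add: same_tensor_def)

lift_definition scaleR_alg_tensor :: "real \<Rightarrow> ('a, 'b) alg_tensor \<Rightarrow> ('a, 'b) alg_tensor"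
  is scale_formal by (simp add: same_tensor_def)

lift_definition uminus_alg_tensor :: "('a, 'b) alg_tensor \<Rightarrow> ('a, 'b) alg_tensor"
  is "scale_formal (-1)" by (simp add: same_tensor_def)

lift_definition minus_alg_tensor :: "('a, 'b) alg_tensor \<Rightarrow> ('a, 'b) alg_tensor \<Rightarrow> ('a, 'b) alg_tensor"
  is "\<lambda>xs ys. xs @ scale_formal (-1) ys" by (simp add: same_tensor_def)

instance
  by standard (transfer, simp add: same_tensor_def algebra_simps)+

end

lift_definition alg_elem :: "'a::real_vector \<Rightarrow> 'b::real_vector \<Rightarrow> ('a, 'b) alg_tensor"
  is "\<lambda>x y. [(x, y)]" .

definition formal_cost :: "('a::real_normed_vector \<times> 'b::real_normed_vector) list \<Rightarrow> real"
  where "formal_cost xs = (\<Sum>(x, y)\<leftarrow>xs. norm x * norm y)"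

definition proj_norm :: "('a::real_normed_vector, 'b::real_normed_vector) alg_tensor \<Rightarrow> real"
  where "proj_norm w = Inf {formal_cost xs | xs. abs_alg_tensor xs = w}"

lemma formal_cost_Nil [simp]: "formal_cost [] = 0"
  and formal_cost_Cons [simp]: "formal_cost (p # xs) = norm (fst p) * norm (snd p) + formal_cost xs"
  and formal_cost_append [simp]: "formal_cost (xs @ ys) = formal_cost xs + formal_cost ys"
  by (simp_all add: formal_cost_def case_prod_beta)

lemma formal_cost_nonneg [simp]: "0 \<le> formal_cost xs"
  by (induction xs) auto

lemma formal_cost_scale [simp]: "formal_cost (scale_formal c xs) = \<bar>c\<bar> * formal_cost xs"
  by (induction xs) (auto simp: scale_formal_def algebra_simps)

lemma proj_norm_le: "proj_norm (abs_alg_tensor xs) \<le> formal_cost xs"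
  unfolding proj_norm_def by (rule cInf_lower) (auto intro: bdd_belowI[of _ 0])

lemma proj_norm_witness:
  assumes "proj_norm w < c"
  obtains xs where "abs_alg_tensor xs = w" "formal_cost xs < c"
proof -
  obtain xs0 where "abs_alg_tensor xs0 = w"
    by (metis Quotient3_abs_rep Quotient3_alg_tensor)
  then have "{formal_cost xs | xs. abs_alg_tensor xs = w} \<noteq> {}" by auto
  from cInf_lessD[OF this, of c] assms show ?thesis
    unfolding proj_norm_def using that by auto
qed

lemma proj_norm_leI:
  assumes "\<And>xs. abs_alg_tensor xs = w \<Longrightarrow> c \<le> formal_cost xs"
  shows "c \<le> proj_norm w"
  by (metis assms linorder_not_le proj_norm_witness order_less_imp_not_less leD)

lemma proj_norm_nonneg [simp]: "0 \<le> proj_norm w"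
  by (rule proj_norm_leI) simp

lemma proj_norm_zero [simp]: "proj_norm 0 = 0"
  unfolding zero_alg_tensor.abs_eq
  by (rule antisym) (use proj_norm_le[of "[]"] in simp_all)

lemma proj_norm_triangle: "proj_norm (v + w) \<le> proj_norm v + proj_norm w"
proof (rule field_le_epsilon)
  fix e :: real assume e: "0 < e"
  obtain xs where xs: "abs_alg_tensor xs = v" "formal_cost xs < proj_norm v + e/2"
    using proj_norm_witness[of v "proj_norm v + e/2"] e by auto
  obtain ys where ys: "abs_alg_tensor ys = w" "formal_cost ys < proj_norm w + e/2"
    using proj_norm_witness[of w "proj_norm w + e/2"] e by auto
  have "proj_norm (v + w) \<le> formal_cost (xs @ ys)"
    using proj_norm_le[of "xs @ ys"] xs(1) ys(1) by (metis plus_alg_tensor.abs_eq)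
  with xs ys show "proj_norm (v + w) \<le> proj_norm v + proj_norm w + e" by simp
qed

lemma proj_norm_scale_le: "proj_norm (c *\<^sub>R w) \<le> \<bar>c\<bar> * proj_norm w"
proof (rule field_le_epsilon)
  fix e :: real assume e: "0 < e"
  obtain xs where xs: "abs_alg_tensor xs = w" "formal_cost xs < proj_norm w + e / (\<bar>c\<bar> + 1)"
    using proj_norm_witness[of w "proj_norm w + e / (\<bar>c\<bar> + 1)"] e by auto
  have "proj_norm (c *\<^sub>R w) \<le> \<bar>c\<bar> * formal_cost xs"
    using proj_norm_le[of "scale_formal c xs"] xs(1) by (metis scaleR_alg_tensor.abs_eq formal_cost_scale)
  also have "\<dots> \<le> \<bar>c\<bar> * (proj_norm w + e / (\<bar>c\<bar> + 1))"
    using xs(2) by (intro mult_left_mono) auto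
  also have "\<dots> \<le> \<bar>c\<bar> * proj_norm w + e"
    using e by (auto simp: field_simps)
  finally show "proj_norm (c *\<^sub>R w) \<le> \<bar>c\<bar> * proj_norm w + e" .
qed

lemma proj_norm_scale [simp]: "proj_norm (c *\<^sub>R w) = \<bar>c\<bar> * proj_norm w"
proof (cases "c = 0")
  case False
  have "proj_norm w = proj_norm (inverse c *\<^sub>R (c *\<^sub>R w))" using False by simp
  also have "\<dots> \<le> \<bar>inverse c\<bar> * proj_norm (c *\<^sub>R w)" by (rule proj_norm_scale_le)
  finally have "\<bar>c\<bar> * proj_norm w \<le> proj_norm (c *\<^sub>R w)"
    using False by (simp add: field_simps abs_inverse)
  with proj_norm_scale_le[of c w] show ?thesis by simp
qed simp

lemma proj_norm_minus [simp]: "proj_norm (- w) = proj_norm w"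
  using proj_norm_scale[of "-1" w] by (simp del: proj_norm_scale)

lemma proj_norm_diff_commute: "proj_norm (v - w) = proj_norm (w - v)"
  using proj_norm_minus[of "v - w"] by simp

lemma proj_norm_diff_triangle: "proj_norm (u - w) \<le> proj_norm (u - v) + proj_norm (v - w)"
  using proj_norm_triangle[of "u - v" "v - w"] by simp

lemma proj_norm_abs_diff: "\<bar>proj_norm v - proj_norm w\<bar> \<le> proj_norm (v - w)"
  using proj_norm_triangle[of "v - w" w] proj_norm_triangle[of "w - v" v] proj_norm_diff_commute[of v w]
  by simp

section \<open>The projective tensor product\<close>

text \<open>
  The completion with respect to \<^const>\<open>proj_norm\<close>: Cauchy sequences modulo sequences whose
  difference tends to zero.  The construction only uses that \<^const>\<open>proj_norm\<close> is a seminorm; that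
  it is definite (which needs the Hahn-Banach theorem) makes \<open>embed_alg\<close> below injective.
\<close>

definition proj_Cauchy :: "(nat \<Rightarrow> ('a::real_normed_vector, 'b::real_normed_vector) alg_tensor) \<Rightarrow> bool"
  where "proj_Cauchy s \<longleftrightarrow> (\<forall>e>0. \<exists>N. \<forall>m\<ge>N. \<forall>n\<ge>N. proj_norm (s m - s n) < e)"

definition same_limit ::
    "(nat \<Rightarrow> ('a::real_normed_vector, 'b::real_normed_vector) alg_tensor) \<Rightarrow> (nat \<Rightarrow> ('a, 'b) alg_tensor) \<Rightarrow> bool"
  where "same_limit s t \<longleftrightarrow> proj_Cauchy s \<and> proj_Cauchy t \<and> (\<lambda>n. proj_norm (s n - t n)) \<longlonglongrightarrow> 0"

lemma proj_null_le:
  assumes "f \<longlonglongrightarrow> 0" "\<And>n. proj_norm (s n) \<le> f n"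
  shows "(\<lambda>n. proj_norm (s n)) \<longlonglongrightarrow> 0"
  by (rule tendsto_sandwich[OF _ _ tendsto_const assms(1)]) (auto simp: assms(2))

lemma proj_Cauchy_const [simp]: "proj_Cauchy (\<lambda>_. w)"
  by (simp add: proj_Cauchy_def)

lemma proj_Cauchy_add: "proj_Cauchy s \<Longrightarrow> proj_Cauchy t \<Longrightarrow> proj_Cauchy (\<lambda>n. s n + t n)"
  unfolding proj_Cauchy_def
proof (intro allI impI)
  fix e :: real
  assume s: "\<forall>e>0. \<exists>N. \<forall>m\<ge>N. \<forall>n\<ge>N. proj_norm (s m - s n) < e"
    and t: "\<forall>e>0. \<exists>N. \<forall>m\<ge>N. \<forall>n\<ge>N. proj_norm (t m - t n) < e" and "0 < e"
  then have "0 < e/2" by simp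
  obtain M where M: "\<forall>m\<ge>M. \<forall>n\<ge>M. proj_norm (s m - s n) < e/2" using s \<open>0 < e/2\<close> by blast
  obtain N where N: "\<forall>m\<ge>N. \<forall>n\<ge>N. proj_norm (t m - t n) < e/2" using t \<open>0 < e/2\<close> by blast
  have "proj_norm (s m + t m - (s n + t n)) < e" if "m \<ge> max M N" "n \<ge> max M N" for m n
  proof -
    have "proj_norm (s m - s n) < e/2" "proj_norm (t m - t n) < e/2" using M N that by auto
    then show ?thesis
      using proj_norm_triangle[of "s m - s n" "t m - t n"] by (simp add: algebra_simps)
  qed
  then show "\<exists>N. \<forall>m\<ge>N. \<forall>n\<ge>N. proj_norm (s m + t m - (s n + t n)) < e" by blast
qed

lemma proj_Cauchy_lipschitz:
  assumes "proj_Cauchy s" and le: "\<And>m n. proj_norm (t m - t n) \<le> c * proj_norm (s m - s n)"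
  shows "proj_Cauchy t"
  unfolding proj_Cauchy_def
proof (intro allI impI)
  fix e :: real assume "0 < e"
  then have "0 < e / (\<bar>c\<bar> + 1)" by auto
  then obtain N where N: "\<forall>m\<ge>N. \<forall>n\<ge>N. proj_norm (s m - s n) < e / (\<bar>c\<bar> + 1)"
    using assms(1) unfolding proj_Cauchy_def by blast
  have "proj_norm (t m - t n) < e" if "m \<ge> N" "n \<ge> N" for m n
  proof -
    have "proj_norm (t m - t n) \<le> (\<bar>c\<bar> + 1) * proj_norm (s m - s n)"
      by (rule order_trans[OF le]) (intro mult_right_mono, auto)
    also have "\<dots> < (\<bar>c\<bar> + 1) * (e / (\<bar>c\<bar> + 1))"
      using N that by (intro mult_strict_left_mono) auto
    also have "\<dots> = e" by (simp add: add_nonneg_eq_0_iff)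
    finally show ?thesis .
  qed
  then show "\<exists>N. \<forall>m\<ge>N. \<forall>n\<ge>N. proj_norm (t m - t n) < e" by blast
qed

lemma proj_Cauchy_scale: "proj_Cauchy s \<Longrightarrow> proj_Cauchy (\<lambda>n. c *\<^sub>R s n)"
  by (erule proj_Cauchy_lipschitz[where c = "\<bar>c\<bar>"]) (simp flip: scaleR_diff_right)

lemma proj_Cauchy_uminus: "proj_Cauchy s \<Longrightarrow> proj_Cauchy (\<lambda>n. - s n)"
  using proj_Cauchy_scale[of s "-1"] by simp

lemma proj_Cauchy_diff: "proj_Cauchy s \<Longrightarrow> proj_Cauchy t \<Longrightarrow> proj_Cauchy (\<lambda>n. s n - t n)"
  using proj_Cauchy_add[of s "\<lambda>n. - t n"] by (simp add: proj_Cauchy_uminus)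

lemma same_limit_refl: "proj_Cauchy s \<Longrightarrow> same_limit s s"
  by (simp add: same_limit_def)

lemma same_limit_add:
  "same_limit s s' \<Longrightarrow> same_limit t t' \<Longrightarrow> same_limit (\<lambda>n. s n + t n) (\<lambda>n. s' n + t' n)"
  unfolding same_limit_def
proof (elim conjE, intro conjI proj_Cauchy_add)
  assume "(\<lambda>n. proj_norm (s n - s' n)) \<longlonglongrightarrow> 0" "(\<lambda>n. proj_norm (t n - t' n)) \<longlonglongrightarrow> 0"
  from tendsto_add[OF this]
  have "(\<lambda>n. proj_norm (s n - s' n) + proj_norm (t n - t' n)) \<longlonglongrightarrow> 0" by simp
  then show "(\<lambda>n. proj_norm (s n + t n - (s' n + t' n))) \<longlonglongrightarrow> 0"
  proof (rule proj_null_le)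
    show "proj_norm (s n + t n - (s' n + t' n)) \<le> proj_norm (s n - s' n) + proj_norm (t n - t' n)" for n
      using proj_norm_triangle[of "s n - s' n" "t n - t' n"] by (simp add: algebra_simps)
  qed
qed

lemma same_limit_scale: "same_limit s t \<Longrightarrow> same_limit (\<lambda>n. c *\<^sub>R s n) (\<lambda>n. c *\<^sub>R t n)"
  unfolding same_limit_def
  by (auto simp: proj_Cauchy_scale tendsto_mult_right_zero simp flip: scaleR_diff_right)

lemma same_limit_uminus: "same_limit s t \<Longrightarrow> same_limit (\<lambda>n. - s n) (\<lambda>n. - t n)"
  using same_limit_scale[of s t "-1"] by simp

lemma same_limit_diff:
  "same_limit s s' \<Longrightarrow> same_limit t t' \<Longrightarrow> same_limit (\<lambda>n. s n - t n) (\<lambda>n. s' n - t' n)"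
  using same_limit_add[of s s' "\<lambda>n. - t n" "\<lambda>n. - t' n"] by (simp add: same_limit_uminus)

lemma proj_norm_convergent:
  assumes "proj_Cauchy s" shows "convergent (\<lambda>n. proj_norm (s n))"
proof (rule Cauchy_convergent, unfold Cauchy_def dist_real_def, intro allI impI)
  fix e :: real assume "0 < e"
  then obtain N where "\<forall>m\<ge>N. \<forall>n\<ge>N. proj_norm (s m - s n) < e"
    using assms unfolding proj_Cauchy_def by blast
  then show "\<exists>M. \<forall>m\<ge>M. \<forall>n\<ge>M. \<bar>proj_norm (s m) - proj_norm (s n)\<bar> < e"
    using proj_norm_abs_diff by (meson le_less_trans)
qed

lemma proj_norm_lim_cong:
  assumes "same_limit s t"
  shows "lim (\<lambda>n. proj_norm (s n)) = lim (\<lambda>n. proj_norm (t n))"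
proof -
  have "(\<lambda>n. proj_norm (s n)) \<longlonglongrightarrow> lim (\<lambda>n. proj_norm (s n))"
    using assms by (simp add: same_limit_def proj_norm_convergent flip: convergent_LIMSEQ_iff)
  moreover have "(\<lambda>n. proj_norm (s n) - proj_norm (t n)) \<longlonglongrightarrow> 0"
    by (rule Lim_null_comparison[of _ "\<lambda>n. proj_norm (s n - t n)"])
      (use assms in \<open>auto simp: same_limit_def proj_norm_abs_diff\<close>)
  ultimately have "(\<lambda>n. proj_norm (t n)) \<longlonglongrightarrow> lim (\<lambda>n. proj_norm (s n))"
    using tendsto_diff by fastforce
  then show ?thesis by (simp add: limI)
qed

lemma part_equivp_same_limit:
  "part_equivp (same_limit :: (nat \<Rightarrow> ('a::real_normed_vector, 'b::real_normed_vector) alg_tensor) \<Rightarrow> _)"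
proof (rule part_equivpI)
  show "\<exists>s :: nat \<Rightarrow> ('a, 'b) alg_tensor. same_limit s s"
    by (rule exI, rule same_limit_refl, rule proj_Cauchy_const)
  show "symp (same_limit :: (nat \<Rightarrow> ('a, 'b) alg_tensor) \<Rightarrow> _)"
    by (auto intro!: sympI simp: same_limit_def proj_norm_diff_commute)
  show "transp (same_limit :: (nat \<Rightarrow> ('a, 'b) alg_tensor) \<Rightarrow> _)"
  proof (rule transpI)
    fix r s t :: "nat \<Rightarrow> ('a, 'b) alg_tensor"
    assume *: "same_limit r s" "same_limit s t"
    have "(\<lambda>n. proj_norm (r n - s n) + proj_norm (s n - t n)) \<longlonglongrightarrow> 0"
      using * tendsto_add[of _ 0 _ _ 0] by (fastforce simp: same_limit_def)
    then have "(\<lambda>n. proj_norm (r n - t n)) \<longlonglongrightarrow> 0"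
      by (rule proj_null_le) (rule proj_norm_diff_triangle)
    with * show "same_limit r t" by (simp add: same_limit_def)
  qed
qed

quotient_type (overloaded) ('a, 'b) ptensor =
  "nat \<Rightarrow> ('a::real_normed_vector, 'b::real_normed_vector) alg_tensor" / partial: same_limit
  by (rule part_equivp_same_limit)

instantiation ptensor :: (real_normed_vector, real_normed_vector) real_normed_vector
begin

lift_definition zero_ptensor :: "('a, 'b) ptensor" is "\<lambda>_. 0"
  by (simp add: same_limit_refl)

lift_definition plus_ptensor :: "('a, 'b) ptensor \<Rightarrow> ('a, 'b) ptensor \<Rightarrow> ('a, 'b) ptensor"
  is "\<lambda>s t n. s n + t n" by (rule same_limit_add)

lift_definition scaleR_ptensor :: "real \<Rightarrow> ('a, 'b) ptensor \<Rightarrow> ('a, 'b) ptensor"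
  is "\<lambda>c s n. c *\<^sub>R s n" by (rule same_limit_scale)

lift_definition uminus_ptensor :: "('a, 'b) ptensor \<Rightarrow> ('a, 'b) ptensor"
  is "\<lambda>s n. - s n" by (rule same_limit_uminus)

lift_definition minus_ptensor :: "('a, 'b) ptensor \<Rightarrow> ('a, 'b) ptensor \<Rightarrow> ('a, 'b) ptensor"
  is "\<lambda>s t n. s n - t n" by (rule same_limit_diff)

lift_definition norm_ptensor :: "('a, 'b) ptensor \<Rightarrow> real"
  is "\<lambda>s. lim (\<lambda>n. proj_norm (s n))" by (rule proj_norm_lim_cong)

definition dist_ptensor :: "('a, 'b) ptensor \<Rightarrow> ('a, 'b) ptensor \<Rightarrow> real"
  where "dist_ptensor v w = norm (v - w)"

definition sgn_ptensor :: "('a, 'b) ptensor \<Rightarrow> ('a, 'b) ptensor"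
  where "sgn_ptensor w = scaleR (inverse (norm w)) w"

definition uniformity_ptensor :: "(('a, 'b) ptensor \<times> ('a, 'b) ptensor) filter"
  where "uniformity_ptensor = (INF e\<in>{0 <..}. principal {(x, y). dist x y < e})"

definition open_ptensor :: "('a, 'b) ptensor set \<Rightarrow> bool"
  where "open_ptensor S = (\<forall>x\<in>S. \<forall>\<^sub>F (x', y) in uniformity. x' = x \<longrightarrow> y \<in> S)"

lemma same_limit_self: "same_limit s s \<longleftrightarrow> proj_Cauchy s"
  by (simp add: same_limit_def)

lemma proj_norm_lim: "proj_Cauchy s \<Longrightarrow> (\<lambda>n. proj_norm (s n)) \<longlonglongrightarrow> lim (\<lambda>n. proj_norm (s n))"
  by (simp add: proj_norm_convergent flip: convergent_LIMSEQ_iff)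

instance
proof
  fix u v w :: "('a, 'b) ptensor" and a b :: real
  show "u + v + w = u + (v + w)" "u + v = v + u" "0 + u = u" "- u + u = 0" "u - v = u + - v"
    "a *\<^sub>R (u + v) = a *\<^sub>R u + a *\<^sub>R v" "(a + b) *\<^sub>R u = a *\<^sub>R u + b *\<^sub>R u"
    "a *\<^sub>R b *\<^sub>R u = (a * b) *\<^sub>R u" "1 *\<^sub>R u = u"
    by (transfer, simp add: same_limit_self algebra_simps proj_Cauchy_add proj_Cauchy_scale
        proj_Cauchy_diff)+
  show "dist u v = norm (u - v)" by (rule dist_ptensor_def)
  show "sgn u = inverse (norm u) *\<^sub>R u" by (rule sgn_ptensor_def)
  show "uniformity = (INF e\<in>{0 <..}. principal {(x :: ('a, 'b) ptensor, y). dist x y < e})"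
    by (rule uniformity_ptensor_def)
  show "open S = (\<forall>x\<in>S. \<forall>\<^sub>F (x', y) in uniformity. x' = x \<longrightarrow> y \<in> S)" for S :: "('a, 'b) ptensor set"
    by (rule open_ptensor_def)
  show "norm u = 0 \<longleftrightarrow> u = 0"
  proof (transfer, unfold same_limit_self)
    fix s :: "nat \<Rightarrow> ('a, 'b) alg_tensor" assume s: "proj_Cauchy s"
    show "lim (\<lambda>n. proj_norm (s n)) = 0 \<longleftrightarrow> same_limit s (\<lambda>_. 0)"
      using proj_norm_lim[OF s] s by (auto simp: same_limit_def dest: limI)
  qed
  show "norm (u + v) \<le> norm u + norm v"
  proof (transfer, unfold same_limit_self)
    fix s t :: "nat \<Rightarrow> ('a, 'b) alg_tensor" assume s: "proj_Cauchy s" and t: "proj_Cauchy t"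
    show "lim (\<lambda>n. proj_norm (s n + t n)) \<le> lim (\<lambda>n. proj_norm (s n)) + lim (\<lambda>n. proj_norm (t n))"
      by (rule LIMSEQ_le[OF proj_norm_lim[OF proj_Cauchy_add[OF s t]]
            tendsto_add[OF proj_norm_lim[OF s] proj_norm_lim[OF t]]]) (auto simp: proj_norm_triangle)
  qed
  show "norm (a *\<^sub>R u) = \<bar>a\<bar> * norm u"
  proof (transfer, unfold same_limit_self)
    fix c and s :: "nat \<Rightarrow> ('a, 'b) alg_tensor" assume "proj_Cauchy s"
    from tendsto_mult_left[OF proj_norm_lim[OF this], of "\<bar>c\<bar>"]
    show "lim (\<lambda>n. proj_norm (c *\<^sub>R s n)) = \<bar>c\<bar> * lim (\<lambda>n. proj_norm (s n))"
      by (intro limI) simp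
  qed
qed

end

definition embed_alg :: "('a::real_normed_vector, 'b::real_normed_vector) alg_tensor \<Rightarrow> ('a, 'b) ptensor"
  where "embed_alg w = abs_ptensor (\<lambda>_. w)"

definition tensor :: "'a::real_normed_vector \<Rightarrow> 'b::real_normed_vector \<Rightarrow> ('a, 'b) ptensor"
  where "tensor x y = embed_alg (alg_elem x y)"

lemma linear_embed_alg: "linear embed_alg"
  by (rule linearI)
    (simp_all add: embed_alg_def plus_ptensor.abs_eq scaleR_ptensor.abs_eq same_limit_refl)

lemma norm_embed_alg [simp]: "norm (embed_alg w) = proj_norm w"
  by (simp add: embed_alg_def norm_ptensor.abs_eq same_limit_refl limI)

lemma embed_alg_tendsto:
  assumes "proj_Cauchy s"
  shows "(\<lambda>n. embed_alg (s n)) \<longlonglongrightarrow> abs_ptensor s"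
proof (rule LIMSEQ_I)
  fix r :: real assume r: "0 < r"
  then obtain N where N: "\<forall>m\<ge>N. \<forall>n\<ge>N. proj_norm (s m - s n) < r/2"
    using assms unfolding proj_Cauchy_def by (meson half_gt_zero)
  have "norm (embed_alg (s n) - abs_ptensor s) < r" if "n \<ge> N" for n
  proof -
    have C: "proj_Cauchy (\<lambda>m. s n - s m)" by (simp add: assms proj_Cauchy_diff)
    have "norm (embed_alg (s n) - abs_ptensor s) = lim (\<lambda>m. proj_norm (s n - s m))"
      by (simp add: embed_alg_def minus_ptensor.abs_eq norm_ptensor.abs_eq same_limit_self assms C)
    also have "\<dots> \<le> r/2"
      by (rule LIMSEQ_le_const2[OF proj_norm_lim[OF C]]) (use N that in \<open>meson less_imp_le\<close>)
    finally show ?thesis using r by simp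
  qed
  then show "\<exists>N. \<forall>n\<ge>N. norm (embed_alg (s n) - abs_ptensor s) < r" by blast
qed

lemma embed_alg_approx:
  fixes w :: "('a::real_normed_vector, 'b::real_normed_vector) ptensor"
  assumes "0 < e" shows "\<exists>v. norm (w - embed_alg v) < e"
proof -
  obtain s where "proj_Cauchy s" "w = abs_ptensor s"
    by (metis Quotient3_abs_rep Quotient3_ptensor Quotient3_rep_reflp same_limit_self)
  then show ?thesis
    using LIMSEQ_D[OF embed_alg_tendsto assms, of s] by (metis norm_minus_commute order_refl)
qed

instance ptensor :: (real_normed_vector, real_normed_vector) banach
proof
  fix X :: "nat \<Rightarrow> ('a, 'b) ptensor" assume X: "Cauchy X"
  have "\<exists>v. norm (X n - embed_alg v) < inverse (real (Suc n))" for n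
    by (rule embed_alg_approx) simp
  then obtain s where s: "\<And>n. norm (X n - embed_alg (s n)) < inverse (real (Suc n))" by metis
  have lim: "(\<lambda>n. X n - embed_alg (s n)) \<longlonglongrightarrow> 0"
    by (rule Lim_null_comparison[OF _ LIMSEQ_inverse_real_of_nat]) (use s in \<open>auto intro!: always_eventually less_imp_le\<close>)
  have "Cauchy (\<lambda>n. embed_alg (s n))"
  proof (rule metric_CauchyI)
    fix e :: real assume "0 < e"
    then have e: "0 < e/3" by simp
    obtain M where M: "\<forall>m\<ge>M. \<forall>n\<ge>M. dist (X m) (X n) < e/3" using metric_CauchyD[OF X e] by blast
    obtain N where N: "\<forall>n\<ge>N. dist (X n) (embed_alg (s n)) < e/3"
      using LIMSEQ_D[OF lim e] by (auto simp: dist_norm)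
    have "dist (embed_alg (s m)) (embed_alg (s n)) < e" if "m \<ge> max M N" "n \<ge> max M N" for m n
    proof -
      have "dist (X m) (X n) < e/3" "dist (X m) (embed_alg (s m)) < e/3" "dist (X n) (embed_alg (s n)) < e/3"
        using M N that by auto
      then show ?thesis
        using dist_triangle[of "embed_alg (s m)" "embed_alg (s n)" "X m"]
          dist_triangle[of "X m" "embed_alg (s n)" "X n"] by (simp add: dist_commute)
    qed
    then show "\<exists>L. \<forall>m\<ge>L. \<forall>n\<ge>L. dist (embed_alg (s m)) (embed_alg (s n)) < e" by blast
  qed
  then have "proj_Cauchy s"
    unfolding Cauchy_def proj_Cauchy_def dist_norm by (simp flip: linear_diff[OF linear_embed_alg])
  from tendsto_add[OF lim embed_alg_tendsto[OF this]]
  show "convergent X" by (auto simp: convergent_def)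
qed

lemma alg_elem_span: "span (range (\<lambda>(x, y). alg_elem x y)) = UNIV"
proof -
  have "abs_alg_tensor xs \<in> span (range (\<lambda>(x, y). alg_elem x y))" for xs :: "('a \<times> 'b) list"
  proof (induction xs)
    case Nil
    show ?case using span_zero by (simp flip: zero_alg_tensor.abs_eq)
  next
    case (Cons p xs)
    have "abs_alg_tensor (p # xs) = alg_elem (fst p) (snd p) + abs_alg_tensor xs"
      by (simp add: alg_elem.abs_eq plus_alg_tensor.abs_eq)
    moreover have "alg_elem (fst p) (snd p) \<in> range (\<lambda>(x, y). alg_elem x y)" by force
    ultimately show ?case using Cons by (simp add: span_add span_base)
  qed
  then show ?thesis by (metis Quotient3_abs_rep Quotient3_alg_tensor UNIV_eq_I)
qed

lemma tensor_dense: "closure (span (range (\<lambda>(x, y). tensor x y))) = UNIV"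
proof -
  have "range embed_alg \<subseteq> span (range (\<lambda>(x, y). tensor x y))"
    by (subst alg_elem_span[symmetric], subst linear_span_image[OF linear_embed_alg, symmetric])
      (auto simp: tensor_def image_image case_prod_beta)
  moreover have "w \<in> closure (range embed_alg)" for w :: "('a, 'b) ptensor"
    using embed_alg_approx[of _ w] by (auto simp: closure_approachable dist_norm norm_minus_commute)
  ultimately show ?thesis by (metis UNIV_eq_I closure_mono subsetD)
qed

section \<open>The operator \<open>K \<otimes>\<^sub>\<pi> K\<close>\<close>

definition ptensor_map ::
    "('a::real_normed_vector \<Rightarrow>\<^sub>L 'b::real_normed_vector) \<Rightarrow> ('a, 'a) ptensor \<Rightarrow>\<^sub>L ('b, 'b) ptensor"
  where "ptensor_map K =
    (THE T. \<forall>u v. blinfun_apply T (tensor u v) = tensor (blinfun_apply K u) (blinfun_apply K v))"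

definition formal_map :: "('a \<Rightarrow> 'b) \<Rightarrow> ('a \<times> 'a) list \<Rightarrow> ('b \<times> 'b) list"
  where "formal_map f xs = map (\<lambda>(x, y). (f x, f y)) xs"

lemma form_val_formal_map: "form_val B (formal_map f xs) = form_val (\<lambda>x y. B (f x) (f y)) xs"
  by (induction xs) (auto simp: formal_map_def)

lift_definition alg_map :: "('a::real_normed_vector \<Rightarrow>\<^sub>L 'b::real_normed_vector) \<Rightarrow> ('a, 'a) alg_tensor \<Rightarrow> ('b, 'b) alg_tensor"
  is "\<lambda>K. formal_map (blinfun_apply K)"
proof -
  fix K :: "'a \<Rightarrow>\<^sub>L 'b" and xs ys :: "('a \<times> 'a) list"
  assume *: "same_tensor xs ys"
  have "bilinear (\<lambda>x y. B (blinfun_apply K x) (blinfun_apply K y))" if "bilinear B" for B :: "'b \<Rightarrow> 'b \<Rightarrow> real"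
    using that by (simp add: bilinear_def linear_iff blinfun.bilinear_simps)
  with * show "same_tensor (formal_map (blinfun_apply K) xs) (formal_map (blinfun_apply K) ys)"
    by (simp add: same_tensor_def form_val_formal_map)
qed

lemma alg_map_elem: "alg_map K (alg_elem u v) = alg_elem (blinfun_apply K u) (blinfun_apply K v)"
  by transfer (simp add: formal_map_def same_tensor_def)

lemma linear_alg_map: "linear (alg_map K)"
proof (rule linearI; transfer)
  show "same_tensor (formal_map (blinfun_apply K) (xs @ ys))
      (formal_map (blinfun_apply K) xs @ formal_map (blinfun_apply K) ys)" for K :: "'a \<Rightarrow>\<^sub>L 'b" and xs ys
    by (simp add: same_tensor_def formal_map_def)
  have "formal_map (blinfun_apply K) (scale_formal c xs) = scale_formal c (formal_map (blinfun_apply K) xs)"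
    for K :: "'a \<Rightarrow>\<^sub>L 'b" and c xs
    by (induction xs) (auto simp: formal_map_def scale_formal_def blinfun.bilinear_simps)
  then show "same_tensor (formal_map (blinfun_apply K) (scale_formal c xs))
      (scale_formal c (formal_map (blinfun_apply K) xs))" for K :: "'a \<Rightarrow>\<^sub>L 'b" and c xs
    by (simp add: same_tensor_def)
qed

lemma proj_norm_alg_map: "proj_norm (alg_map K w) \<le> (norm K)\<^sup>2 * proj_norm w"
proof (rule field_le_epsilon)
  fix e :: real assume e: "0 < e"
  define c where "c = (norm K)\<^sup>2"
  have c: "0 \<le> c" by (simp add: c_def)
  obtain xs where xs: "abs_alg_tensor xs = w" "formal_cost xs < proj_norm w + e / (c + 1)"
    using proj_norm_witness[of w "proj_norm w + e / (c + 1)"] e c by auto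
  have cost: "formal_cost (formal_map (blinfun_apply K) ys) \<le> c * formal_cost ys" for ys
  proof (induction ys)
    case (Cons p ys)
    have "norm (blinfun_apply K (fst p)) * norm (blinfun_apply K (snd p))
        \<le> (norm K * norm (fst p)) * (norm K * norm (snd p))"
      by (intro mult_mono norm_blinfun) auto
    with Cons show ?case
      by (auto simp: formal_map_def c_def power2_eq_square algebra_simps case_prod_beta)
  qed (simp add: formal_map_def)
  have "proj_norm (alg_map K w) \<le> formal_cost (formal_map (blinfun_apply K) xs)"
    using proj_norm_le[of "formal_map (blinfun_apply K) xs"] xs(1) by (metis alg_map.abs_eq)
  also have "\<dots> \<le> c * (proj_norm w + e / (c + 1))"
    using cost[of xs] xs(2) c by (meson less_imp_le mult_left_mono order_trans)
  also have "\<dots> \<le> c * proj_norm w + e"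
    using e c by (auto simp: field_simps)
  finally show "proj_norm (alg_map K w) \<le> (norm K)\<^sup>2 * proj_norm w + e" by (simp add: c_def)
qed

lemma proj_norm_alg_map_diff: "proj_norm (alg_map K v - alg_map K w) \<le> (norm K)\<^sup>2 * proj_norm (v - w)"
  using proj_norm_alg_map[of K "v - w"] by (simp add: linear_diff[OF linear_alg_map])

lemma proj_Cauchy_alg_map: "proj_Cauchy s \<Longrightarrow> proj_Cauchy (\<lambda>n. alg_map K (s n))"
  by (erule proj_Cauchy_lipschitz) (rule proj_norm_alg_map_diff)

lift_definition ext_map :: "('a::real_normed_vector \<Rightarrow>\<^sub>L 'b::real_normed_vector) \<Rightarrow> ('a, 'a) ptensor \<Rightarrow> ('b, 'b) ptensor"
  is "\<lambda>K s n. alg_map K (s n)"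
proof -
  fix K :: "'a \<Rightarrow>\<^sub>L 'b" and s t :: "nat \<Rightarrow> ('a, 'a) alg_tensor"
  assume *: "same_limit s t"
  have "(\<lambda>n. proj_norm (alg_map K (s n) - alg_map K (t n))) \<longlonglongrightarrow> 0"
  proof (rule proj_null_le)
    show "(\<lambda>n. (norm K)\<^sup>2 * proj_norm (s n - t n)) \<longlonglongrightarrow> 0"
      using * by (simp add: same_limit_def tendsto_mult_right_zero)
  qed (rule proj_norm_alg_map_diff)
  with * show "same_limit (\<lambda>n. alg_map K (s n)) (\<lambda>n. alg_map K (t n))"
    by (simp add: same_limit_def proj_Cauchy_alg_map)
qed

lemma ext_map_tensor: "ext_map K (tensor u v) = tensor (blinfun_apply K u) (blinfun_apply K v)"
  unfolding tensor_def alg_map_elem[symmetric]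
  by (simp add: embed_alg_def ext_map.abs_eq same_limit_refl)

lemma bounded_linear_ext_map:
  fixes K :: "'a::real_normed_vector \<Rightarrow>\<^sub>L 'b::real_normed_vector"
  shows "bounded_linear (ext_map K)"
proof (rule bounded_linear_intro[where K = "(norm K)\<^sup>2"])
  show "ext_map K (v + w) = ext_map K v + ext_map K w" for v w
    by (transfer fixing: K) (simp add: linear_add[OF linear_alg_map] same_limit_self proj_Cauchy_alg_map proj_Cauchy_add)
  show "ext_map K (c *\<^sub>R w) = c *\<^sub>R ext_map K w" for c w
    by (transfer fixing: K) (simp add: linear_scale[OF linear_alg_map] same_limit_self proj_Cauchy_alg_map proj_Cauchy_scale)
  show "norm (ext_map K w) \<le> norm w * (norm K)\<^sup>2" for w
  proof (transfer fixing: K, unfold same_limit_self)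
    fix s :: "nat \<Rightarrow> ('a, 'a) alg_tensor" assume s: "proj_Cauchy s"
    show "lim (\<lambda>n. proj_norm (alg_map K (s n))) \<le> lim (\<lambda>n. proj_norm (s n)) * (norm K)\<^sup>2"
      by (rule LIMSEQ_le[OF proj_norm_lim[OF proj_Cauchy_alg_map[OF s]]
            tendsto_mult_right[OF proj_norm_lim[OF s]]])
        (use proj_norm_alg_map in \<open>auto simp: mult.commute\<close>)
  qed
qed

lemma blinfun_eq_on_tensors:
  fixes S T :: "('a::real_normed_vector, 'b::real_normed_vector) ptensor \<Rightarrow>\<^sub>L 'c::real_normed_vector"
  assumes "\<And>u v. blinfun_apply S (tensor u v) = blinfun_apply T (tensor u v)"
  shows "S = T"
proof (rule blinfun_eqI)
  fix w
  let ?E = "{w. blinfun_apply S w = blinfun_apply T w}"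
  have "span (range (\<lambda>(x, y). tensor x y)) \<subseteq> ?E"
    by (rule span_minimal) (auto simp: assms subspace_def blinfun.bilinear_simps)
  moreover have "closed ?E" by (intro closed_Collect_eq continuous_intros)
  ultimately have "closure (span (range (\<lambda>(x, y). tensor x y))) \<subseteq> ?E" by (rule closure_minimal)
  then show "blinfun_apply S w = blinfun_apply T w" by (auto simp: tensor_dense)
qed

lemma ptensor_map_tensor [simp]:
  "blinfun_apply (ptensor_map K) (tensor u v) = tensor (blinfun_apply K u) (blinfun_apply K v)"
proof -
  let ?P = "\<lambda>T. \<forall>u v. blinfun_apply T (tensor u v) = tensor (blinfun_apply K u) (blinfun_apply K v)"
  have *: "?P (Blinfun (ext_map K))"
    by (simp add: bounded_linear_Blinfun_apply[OF bounded_linear_ext_map] ext_map_tensor)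
  have "\<exists>!T. ?P T"
  proof (rule ex1I[of ?P, OF *])
    show "T = Blinfun (ext_map K)" if "?P T" for T
      by (rule blinfun_eq_on_tensors) (use that * in simp)
  qed
  from theI'[OF this] show ?thesis unfolding ptensor_map_def by blast
qed

section \<open>The symmetric projective tensor product\<close>

typedef (overloaded) 'a symtensor =
  "closure (span (range (\<lambda>u. tensor u u))) :: ('a::real_normed_vector, 'a) ptensor set"
  by (meson closure_subset span_zero subsetD)

setup_lifting type_definition_symtensor

lemma subspace_closure:
  fixes S :: "'a::real_normed_vector set"
  assumes "subspace S" shows "subspace (closure S)"
proof (rule subspaceI)
  show "0 \<in> closure S" using subspace_0[OF assms] closure_subset by blast
  show "c *\<^sub>R x \<in> closure S" if *: "x \<in> closure S" for c x
  proof -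
    obtain f where "\<forall>n. f n \<in> S" "f \<longlonglongrightarrow> x" using * unfolding closure_sequential by blast
    then show ?thesis unfolding closure_sequential
      by (intro exI[of _ "\<lambda>n. c *\<^sub>R f n"]) (simp add: subspace_scale[OF assms] tendsto_scaleR)
  qed
  show "x + y \<in> closure S" if *: "x \<in> closure S" "y \<in> closure S" for x y
  proof -
    obtain f g where "\<forall>n. f n \<in> S" "f \<longlonglongrightarrow> x" "\<forall>n. g n \<in> S" "g \<longlonglongrightarrow> y"
      using * unfolding closure_sequential by blast
    then show ?thesis unfolding closure_sequential
      by (intro exI[of _ "\<lambda>n. f n + g n"]) (simp add: subspace_add[OF assms] tendsto_add)
  qed
qed

lemma subspace_sym: "subspace (closure (span (range (\<lambda>u. tensor u u))))"
  by (intro subspace_closure subspace_span)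

instantiation symtensor :: (real_normed_vector) real_normed_vector
begin

lift_definition zero_symtensor :: "'a symtensor" is 0
  by (rule subspace_0[OF subspace_sym])

lift_definition plus_symtensor :: "'a symtensor \<Rightarrow> 'a symtensor \<Rightarrow> 'a symtensor" is "(+)"
  by (rule subspace_add[OF subspace_sym])

lift_definition minus_symtensor :: "'a symtensor \<Rightarrow> 'a symtensor \<Rightarrow> 'a symtensor" is "(-)"
  by (rule subspace_diff[OF subspace_sym])

lift_definition uminus_symtensor :: "'a symtensor \<Rightarrow> 'a symtensor" is uminus
  by (rule subspace_neg[OF subspace_sym])

lift_definition scaleR_symtensor :: "real \<Rightarrow> 'a symtensor \<Rightarrow> 'a symtensor" is scaleR
  by (rule subspace_scale[OF subspace_sym])

lift_definition norm_symtensor :: "'a symtensor \<Rightarrow> real" is norm .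

definition dist_symtensor :: "'a symtensor \<Rightarrow> 'a symtensor \<Rightarrow> real"
  where "dist_symtensor v w = norm (v - w)"

definition sgn_symtensor :: "'a symtensor \<Rightarrow> 'a symtensor"
  where "sgn_symtensor w = scaleR (inverse (norm w)) w"

definition uniformity_symtensor :: "('a symtensor \<times> 'a symtensor) filter"
  where "uniformity_symtensor = (INF e\<in>{0 <..}. principal {(x, y). dist x y < e})"

definition open_symtensor :: "'a symtensor set \<Rightarrow> bool"
  where "open_symtensor S = (\<forall>x\<in>S. \<forall>\<^sub>F (x', y) in uniformity. x' = x \<longrightarrow> y \<in> S)"

instance
proof
  fix u v w :: "'a symtensor" and a b :: real
  show "u + v + w = u + (v + w)" "u + v = v + u" "0 + u = u" "- u + u = 0" "u - v = u + - v"
    "a *\<^sub>R (u + v) = a *\<^sub>R u + a *\<^sub>R v" "(a + b) *\<^sub>R u = a *\<^sub>R u + b *\<^sub>R u"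
    "a *\<^sub>R b *\<^sub>R u = (a * b) *\<^sub>R u" "1 *\<^sub>R u = u" "norm u = 0 \<longleftrightarrow> u = 0"
    "norm (u + v) \<le> norm u + norm v" "norm (a *\<^sub>R u) = \<bar>a\<bar> * norm u"
    by (transfer, simp add: algebra_simps norm_triangle_ineq)+
qed (rule dist_symtensor_def sgn_symtensor_def uniformity_symtensor_def open_symtensor_def)+

end

lift_definition tensor_square :: "'a::real_normed_vector \<Rightarrow> 'a symtensor" is "\<lambda>u. tensor u u"
  by (meson closure_subset rangeI span_base subsetD)

lemma ptensor_map_sym:
  assumes "w \<in> closure (span (range (\<lambda>u. tensor u u)))"
  shows "blinfun_apply (ptensor_map K) w \<in> closure (span (range (\<lambda>u. tensor u u)))"
proof -
  have "blinfun_apply (ptensor_map K) ` span (range (\<lambda>u. tensor u u))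
      = span (blinfun_apply (ptensor_map K) ` range (\<lambda>u. tensor u u))"
    by (simp add: linear_span_image bounded_linear.linear blinfun.bounded_linear_right)
  also have "\<dots> \<subseteq> span (range (\<lambda>u. tensor u u))"
    by (rule span_mono) auto
  finally have "blinfun_apply (ptensor_map K) ` span (range (\<lambda>u. tensor u u)) \<subseteq> closure (span (range (\<lambda>u. tensor u u)))"
    using closure_subset by blast
  then have "blinfun_apply (ptensor_map K) ` closure (span (range (\<lambda>u. tensor u u))) \<subseteq> closure (span (range (\<lambda>u. tensor u u)))"
    by (intro image_closure_subset continuous_intros closed_closure)
  with assms show ?thesis by blast
qed

lift_definition sym_restrict :: "('a::real_normed_vector \<Rightarrow>\<^sub>L 'b::real_normed_vector) \<Rightarrow> 'a symtensor \<Rightarrow> 'b symtensor"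
  is "\<lambda>K. blinfun_apply (ptensor_map K)" by (rule ptensor_map_sym)

lemma bounded_linear_sym_restrict: "bounded_linear (sym_restrict K)"
proof (rule bounded_linear_intro[where K = "norm (ptensor_map K)"])
  show "sym_restrict K (v + w) = sym_restrict K v + sym_restrict K w" for v w
    by transfer (rule blinfun.add_right)
  show "sym_restrict K (c *\<^sub>R w) = c *\<^sub>R sym_restrict K w" for c w
    by transfer (rule blinfun.scaleR_right)
  show "norm (sym_restrict K w) \<le> norm w * norm (ptensor_map K)" for w
    by transfer (metis norm_blinfun mult.commute)
qed

lift_definition symtensor_map ::
    "('a::real_normed_vector \<Rightarrow>\<^sub>L 'b::real_normed_vector) \<Rightarrow> 'a symtensor \<Rightarrow>\<^sub>L 'b symtensor"
  is sym_restrict by (rule bounded_linear_sym_restrict)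

lemma symtensor_map_square [simp]: "blinfun_apply (symtensor_map K) (tensor_square u) = tensor_square (blinfun_apply K u)"
  by (simp add: symtensor_map.rep_eq) (transfer, simp)

section \<open>Adjoints and product operators\<close>

lift_definition prod_blinfun :: "('a::real_normed_vector \<Rightarrow>\<^sub>L 'c::real_normed_vector) \<Rightarrow>
    ('b::real_normed_vector \<Rightarrow>\<^sub>L 'd::real_normed_vector) \<Rightarrow> ('a \<times> 'b) \<Rightarrow>\<^sub>L ('c \<times> 'd)"
  is "\<lambda>S T (u, w). (S u, T w)"
  unfolding case_prod_beta
  by (intro bounded_linear_Pair bounded_linear_compose[OF _ bounded_linear_fst]
      bounded_linear_compose[OF _ bounded_linear_snd])

definition dual_map :: "('a::real_normed_vector \<Rightarrow>\<^sub>L 'b::real_normed_vector) \<Rightarrow> ('b \<Rightarrow>\<^sub>L real) \<Rightarrow> ('a \<Rightarrow>\<^sub>L real)"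
  where "dual_map T f = f o\<^sub>L T"

text \<open>
  The identification of pairs of functionals with functionals on the product,
  \<open>(\<xi>, \<Xi>) \<mapsto> ((u, w) \<mapsto> \<xi> u + \<Xi> w)\<close>, and its inverse.
\<close>

lemma bounded_linear_join:
  assumes "bounded_linear f" "bounded_linear g"
  shows "bounded_linear (\<lambda>(u, w). f u + g w)"
  unfolding case_prod_beta
  by (rule bounded_linear_add[OF bounded_linear_compose[OF assms(1) bounded_linear_fst]
        bounded_linear_compose[OF assms(2) bounded_linear_snd]])

definition dual_join :: "('a::real_normed_vector \<Rightarrow>\<^sub>L real) \<times> ('b::real_normed_vector \<Rightarrow>\<^sub>L real) \<Rightarrow> ('a \<times> 'b) \<Rightarrow>\<^sub>L real"
  where "dual_join = (\<lambda>(\<xi>, \<Xi>). Blinfun (\<lambda>(u, w). blinfun_apply \<xi> u + blinfun_apply \<Xi> w))"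

definition dual_split :: "(('a::real_normed_vector \<times> 'b::real_normed_vector) \<Rightarrow>\<^sub>L real) \<Rightarrow> ('a \<Rightarrow>\<^sub>L real) \<times> ('b \<Rightarrow>\<^sub>L real)"
  where "dual_split f = (Blinfun (\<lambda>u. blinfun_apply f (u, 0)), Blinfun (\<lambda>w. blinfun_apply f (0, w)))"

lemma dual_join_apply [simp]:
  "blinfun_apply (dual_join (\<xi>, \<Xi>)) (u, w) = blinfun_apply \<xi> u + blinfun_apply \<Xi> w"
  by (simp add: dual_join_def bounded_linear_Blinfun_apply[OF bounded_linear_join]
      blinfun.bounded_linear_right)

lemma dual_split_apply [simp]:
  "blinfun_apply (fst (dual_split f)) u = blinfun_apply f (u, 0)"
  "blinfun_apply (snd (dual_split f)) w = blinfun_apply f (0, w)"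
proof -
  have "bounded_linear (\<lambda>u. blinfun_apply f (u, 0))" "bounded_linear (\<lambda>w. blinfun_apply f (0, w))"
    using bounded_linear_compose[OF blinfun.bounded_linear_right
        bounded_linear_Pair[OF bounded_linear_ident bounded_linear_zero]]
      bounded_linear_compose[OF blinfun.bounded_linear_right
        bounded_linear_Pair[OF bounded_linear_zero bounded_linear_ident]] by auto
  then show "blinfun_apply (fst (dual_split f)) u = blinfun_apply f (u, 0)"
    "blinfun_apply (snd (dual_split f)) w = blinfun_apply f (0, w)"
    by (simp_all add: dual_split_def bounded_linear_Blinfun_apply)
qed

lemma dual_split_join [simp]: "dual_split (dual_join p) = p"
  by (cases p) (auto intro!: prod_eqI blinfun_eqI simp: blinfun.bilinear_simps)

lemma dual_join_split [simp]: "dual_join (dual_split f) = f"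
proof (rule blinfun_eqI)
  fix x :: "'a \<times> 'b"
  obtain u w where x: "x = (u, w)" by (cases x)
  have "blinfun_apply (dual_join (dual_split f)) x = blinfun_apply f (u, 0) + blinfun_apply f (0, w)"
    unfolding x by (subst prod.collapse[symmetric]) (simp only: dual_join_apply dual_split_apply)
  also have "\<dots> = blinfun_apply f x" by (simp add: x flip: blinfun.add_right)
  finally show "blinfun_apply (dual_join (dual_split f)) x = blinfun_apply f x" .
qed

definition adjoint_prod ::
    "('a::real_normed_vector \<times> 'b::real_normed_vector) \<Rightarrow>\<^sub>L ('c::real_normed_vector \<times> 'd::real_normed_vector) \<Rightarrow>
      ('c \<Rightarrow>\<^sub>L real) \<times> ('d \<Rightarrow>\<^sub>L real) \<Rightarrow> ('a \<Rightarrow>\<^sub>L real) \<times> ('b \<Rightarrow>\<^sub>L real)"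
  where "adjoint_prod T p = dual_split (dual_map T (dual_join p))"

section \<open>Diconvex mappings and the dilinear subdifferential\<close>

definition proper :: "('a \<Rightarrow> ereal) \<Rightarrow> bool"
  where "proper G \<longleftrightarrow> (\<forall>x. G x \<noteq> -\<infinity>) \<and> (\<exists>x. G x \<noteq> \<infinity>)"

text \<open>
  Convexity is only used together with \<^const>\<open>proper\<close>, so the sum below is never of the
  form \<open>\<infinity> - \<infinity>\<close>.
\<close>

definition ereal_convex :: "('a::real_vector \<Rightarrow> ereal) \<Rightarrow> bool"
  where "ereal_convex G \<longleftrightarrow>
    (\<forall>x y. \<forall>t::real. 0 < t \<and> t < 1 \<longrightarrow>
      G (t *\<^sub>R x + (1 - t) *\<^sub>R y) \<le> ereal t * G x + ereal (1 - t) * G y)"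

definition diconvex :: "('a::real_normed_vector \<Rightarrow> ereal) \<Rightarrow> bool"
  where "diconvex F \<longleftrightarrow>
    (\<exists>G :: 'a \<times> 'a symtensor \<Rightarrow> ereal. proper G \<and> ereal_convex G \<and> (\<forall>u. F u = G (u, tensor_square u)))"

definition dilinear_subdiff ::
    "('a::real_normed_vector \<Rightarrow> ereal) \<Rightarrow> 'a \<Rightarrow> (('a \<Rightarrow>\<^sub>L real) \<times> ('a symtensor \<Rightarrow>\<^sub>L real)) set"
  where "dilinear_subdiff F u =
    {(\<xi>, \<Xi>). \<bar>F u\<bar> \<noteq> \<infinity> \<and>
      (\<forall>v. F v \<ge> F u + ereal (blinfun_apply \<xi> (v - u)) + ereal (blinfun_apply \<Xi> (tensor_square v - tensor_square u)))}"

end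

theory Submission
  imports Defs
begin

text \<open>The adjoint composes the two functionals with \<open>K\<close> and
  \<open>symtensor_map K\<close>. As the latter sends the square of \<open>v\<close> to that of
  \<open>K v\<close>, the inequality for the composite at \<open>v\<close> is that for
  \<open>F\<close> at \<open>K v\<close>.\<close>

lemma prod_blinfun_apply [simp]:
  "blinfun_apply (prod_blinfun S T) (u, w) = (blinfun_apply S u, blinfun_apply T w)"
  by (simp add: prod_blinfun.rep_eq)

lemma dual_map_apply [simp]: "blinfun_apply (dual_map T f) x = blinfun_apply f (blinfun_apply T x)"
  by (simp add: dual_map_def)

text \<open>On (x, 0) and (0, w) one summand of \<open>dual_join\<close> vanishes, so the adjoint
  decouples.\<close>

lemma adjoint_prod_prod_blinfun:
  "adjoint_prod (prod_blinfun S T) (\<xi>, \<Xi>) = (dual_map S \<xi>, dual_map T \<Xi>)"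
  by (auto intro!: prod_eqI blinfun_eqI simp: adjoint_prod_def blinfun.zero_right)

theorem proposition3p11:
  fixes K :: "'a::banach \<Rightarrow>\<^sub>L 'b::banach"
    and F :: "'b \<Rightarrow> ereal"
    and u :: 'a
  assumes "diconvex F"
  shows "adjoint_prod (prod_blinfun K (symtensor_map K)) ` dilinear_subdiff F (blinfun_apply K u)
    \<subseteq> dilinear_subdiff (F \<circ> blinfun_apply K) u"
  \<comment> \<open>Splitting differences exposes single squares to
    \<open>symtensor_map_square\<close>.\<close>
  by (auto simp: dilinear_subdiff_def adjoint_prod_prod_blinfun blinfun.diff_right)

end
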